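(* Let $q$ be a prime power and let $n,k$ be integers. If $1\le k\le n$, then $$\mathcal{C}_q(n,k,1)=\left\lceil \frac{q^n-1}{q^k-1}\right\rceil .$$
   Context: $\mathcal{G}_q(n,k)$ denotes the set of all $k$-dimensional subspaces of $\mathbb{F}_q^n$. For $0\le r\le k\le n$, a $q$-covering design $C_q[n,k,r]$ is a set $\mathbb{S}\subseteq\mathcal{G}_q(n,k)$ such that each element of $\mathcal{G}_q(n,r)$ is contained in at least one element of $\mathbb{S}$. The $q$-covering number $\mathcal{C}_q(n,k,r)$ is the minimum size of a $q$-covering design $C_q[n,k,r]$. *)

theory Defs
  imports "HOL-Analysis.Analysis" "HOL-Number_Theory.Prime_Powers"
begin

text \<open>
  \<open>\<F>\<^sub>q\<^sup>n\<close> is \<^typ>\<open>'a ^ 'n\<close> for a finite field type \<open>'a\<close> with \<open>q\<close> elements and an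
  index type \<open>'n\<close> with \<open>n\<close> elements.  The \<open>vec\<close> versions of subspace and dimension
  are the ones with scalars in \<open>'a\<close>; the unqualified \<^const>\<open>subspace\<close> and
  \<^const>\<open>dim\<close> refer to real vector spaces.
\<close>

definition subspaces_of_dim :: "nat \<Rightarrow> ('a::field ^ 'n::finite) set set" where
  "subspaces_of_dim k = {U. vec.subspace U \<and> vec.dim U = k}"

definition q_covering_design ::
    "nat \<Rightarrow> nat \<Rightarrow> ('a::field ^ 'n::finite) set set \<Rightarrow> bool" where
  "q_covering_design k r S \<longleftrightarrow>
     S \<subseteq> subspaces_of_dim k \<and> (\<forall>T\<in>subspaces_of_dim r. \<exists>U\<in>S. T \<subseteq> U)"

text \<open>
  For \<open>r \<le> k \<le> n\<close> the set of all \<open>k\<close>-dimensional subspaces is a covering design, so the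
  minimum exists; every covering design is finite because \<open>'a\<close> and \<open>'n\<close> are.
  For other parameters the value is irrelevant.
\<close>

definition q_covering_number ::
    "'a::{finite,field} itself \<Rightarrow> 'n::finite itself \<Rightarrow> nat \<Rightarrow> nat \<Rightarrow> nat" where
  "q_covering_number _ _ k r =
     (LEAST m. \<exists>S :: ('a ^ 'n) set set. q_covering_design k r S \<and> card S = m)"

end

theory Submission
  imports Defs "HOL-Algebra.Algebraic_Closure_Type" "HOL-Number_Theory.Residues"
begin

text \<open>
  Let \<open>q\<close> be the order of the field. The \<open>q ^ n - 1\<close> nonzero vectors must be covered by
  subspaces that have \<open>q ^ k - 1\<close> nonzero vectors each, so the right-hand side is a lower
  bound (\<open>q_covering_design_card_ge\<close>). A one-dimensional subspace lies in \<open>U\<close> as soon as one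
  of its nonzero vectors does, so it remains to cover all vectors by that many subspaces.

  Write \<open>n = m + k\<close> with \<open>m \<ge> 1\<close>, and let \<open>L\<close> be the extension field of order \<open>q ^ m\<close>. Choose
  linear maps \<open>P\<close> and \<open>R\<close> from the space to \<open>L\<close> such that \<open>P\<close> maps \<open>ker R\<close> onto \<open>L\<close> and \<open>R\<close>
  has the largest rank that this permits, \<open>min m k\<close>. For \<open>\<alpha> \<in> L\<close> the map \<open>P - \<alpha> R\<close> is onto \<open>L\<close>,
  so its kernel has dimension \<open>k\<close>. A vector \<open>v\<close> with \<open>R v \<noteq> 0\<close> lies in the kernel for
  \<open>\<alpha> = P v / R v\<close>; this is where the multiplication of \<open>L\<close> is used. Hence \<open>q ^ m\<close> subspaces of
  dimension \<open>k\<close> cover everything outside \<open>ker R\<close>, which has dimension \<open>max m k\<close>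
  (\<open>exists_graph_cover\<close>).

  If \<open>m \<ge> k\<close>, continue with \<open>ker R\<close> of dimension \<open>m = n - k\<close>; if \<open>m < k\<close>, then \<open>ker R\<close> is one further
  subspace of dimension \<open>k\<close>. The number of subspaces obeys the recursion of the
  right-hand side, because
  \<open>(q ^ n - 1) / (q ^ k - 1) = q ^ m + (q ^ m - 1) / (q ^ k - 1)\<close> and the last fraction has
  ceiling \<open>1\<close> when \<open>0 < m < k\<close> (\<open>exists_cover\<close>).
\<close>

section \<open>The field with q ^ m elements inside the algebraic closure\<close>

lemma CARD_field_gt_1: "CARD('a::{finite,field}) > 1"
  using card_mono[of "UNIV::'a set" "{0, 1}"] by simp

text \<open>
  Multiplication by \<open>x \<noteq> 0\<close> permutes the nonzero elements; comparing their products
  gives \<open>x ^ (CARD('a) - 1) = 1\<close>.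
\<close>

lemma field_power_CARD_eq:
  fixes x :: "'a::{finite,field}"
  shows "x ^ CARD('a) = x"
proof (cases "x = 0")
  case False
  have "\<Prod>(UNIV - {0}) = (\<Prod>y\<in>UNIV-{0}. x * y)"
    by (rule prod.reindex_bij_witness[of _ "\<lambda>y. x * y" "\<lambda>y. y / x"]) (use False in auto)
  also have "\<dots> = x ^ (CARD('a) - 1) * \<Prod>(UNIV - {0})"
    by (simp add: prod.distrib)
  finally have "x ^ (CARD('a) - 1) = 1"
    by simp
  then have "x ^ Suc (CARD('a) - 1) = x"
    by (subst power_Suc) simp
  moreover have "Suc (CARD('a) - 1) = CARD('a)"
    by simp
  ultimately show ?thesis
    by metis
qed simp

lemma field_power_CARD_power_eq:
  fixes x :: "'a::{finite,field}"
  shows "x ^ (CARD('a) ^ m) = x"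
  by (induction m) (simp_all add: field_power_CARD_eq power_mult)

text \<open>
  If \<open>N\<close> vanishes in the field, the derivative of \<open>X ^ N - X\<close> is the constant \<open>-1\<close>, so this
  polynomial has no multiple roots. Being a product of \<open>N\<close> linear factors, it has \<open>N\<close> roots.
\<close>

lemma card_power_fixpoints_alg_closed:
  fixes N :: nat
  assumes N: "N > 1" and N0: "of_nat N = (0::'f::alg_closed_field)"
  shows "card {x::'f. x ^ N = x} = N"
proof -
  define f :: "'f poly" where "f = Polynomial.monom 1 N + [:0, -1:]"
  have deg: "Polynomial.degree f = N"
    unfolding f_def using N
    by (subst Polynomial.degree_add_eq_left) (simp_all add: Polynomial.degree_monom_eq)
  have f0: "f \<noteq> 0"
    using deg N by auto
  have lc: "Polynomial.coeff f (Polynomial.degree f) = 1"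
    using N unfolding deg by (simp add: f_def coeff_pCons split: nat.split)
  have pf: "poly f x = x ^ N - x" for x
    by (simp add: f_def Polynomial.poly_monom)
  have deriv: "pderiv f = [:-1:]"
    by (simp add: f_def pderiv_add pderiv_monom N0 pderiv_pCons)
  obtain A where A: "size A = N" "f = (\<Prod>a\<in>#A. [:-a, 1:])"
    using alg_closed_imp_factorization[OF f0] deg lc by auto
  have simple: "count A a = 1" if a: "a \<in># A" for a
  proof (rule ccontr)
    assume "count A a \<noteq> 1"
    obtain A1 where A1: "A = add_mset a A1"
      using a by (metis multi_member_split)
    with \<open>count A a \<noteq> 1\<close> have "a \<in># A1"
      by (auto simp: not_in_iff)
    then obtain A2 where A2: "A1 = add_mset a A2"
      by (metis multi_member_split)
    define h where "h = (\<Prod>a\<in>#A2. [:-a, 1:])"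
    have "f = [:-a, 1:] * ([:-a, 1:] * h)"
      unfolding A(2) A1 A2 h_def by simp
    then have "poly (pderiv f) a = 0"
      by (simp only: pderiv_mult poly_add poly_mult) simp
    then show False
      by (simp add: deriv)
  qed
  have "{x. x ^ N = x} = set_mset A"
  proof -
    have "poly f x = 0 \<longleftrightarrow> x \<in># A" for x
      by (simp add: A(2) poly_prod_mset prod_mset_zero_iff image_iff)
    then show ?thesis
      by (auto simp: pf)
  qed
  moreover have "mset_set (set_mset A) = A"
    using simple by (intro multiset_eqI) (auto simp: count_mset_set' not_in_iff)
  ultimately show ?thesis
    using A(1) by (metis size_mset_set)
qed

text \<open>
  The order of the field is a power of the characteristic, so this is the Frobenius
  identity. It makes the fixed points of \<open>x \<mapsto> x ^ (CARD('a) ^ m)\<close> a field.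
\<close>

lemma power_CARD_power_add:
  fixes x y :: "'a::{finite,field} alg_closure"
  assumes "primepow CARD('a)"
  shows "(x + y) ^ (CARD('a) ^ m) = x ^ (CARD('a) ^ m) + y ^ (CARD('a) ^ m)"
proof -
  have prime: "Factorial_Ring.prime CHAR('a)"
    by (intro prime_CHAR_semidom finite_imp_CHAR_pos) simp
  obtain p e where pe: "Factorial_Ring.prime p" "CARD('a) = p ^ e"
    using assms by (auto simp: primepow_def)
  then have "CHAR('a) = p"
    using CHAR_dvd_CARD[where 'a='a] prime prime_dvd_power primes_dvd_imp_eq by metis
  then show ?thesis
    using prime pe(2) by (intro freshmans_dream'[where n = "e * m"]) (simp_all add: power_mult)
qed

lemma card_alg_closure_subfield:
  assumes "m \<ge> 1"
  shows "card {x::'a::{finite,field} alg_closure. x ^ (CARD('a) ^ m) = x} = CARD('a) ^ m"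
proof (rule card_power_fixpoints_alg_closed)
  show "CARD('a) ^ m > 1"
    using assms by (intro one_less_power CARD_field_gt_1) simp
  have "of_nat CARD('a) = (0::'a)"
    using CHAR_dvd_CARD by (subst of_nat_eq_0_iff_char_dvd)
  then show "of_nat (CARD('a) ^ m) = (0::'a alg_closure)"
    using assms by (metis of_nat_power to_ac_of_nat to_ac_0 power_0_left not_one_le_zero)
qed

section \<open>Counting vectors\<close>

text \<open>
  This is stated for an arbitrary scalar multiplication because it is applied both to
  \<open>'a ^ 'n\<close> and to the extension field as a vector space over \<open>'a\<close>. In this way dimensions
  can be read off from cardinalities.
\<close>

lemma card_span_independent:
  fixes scale :: "'a::{finite,field} \<Rightarrow> 'b::ab_group_add \<Rightarrow> 'b"
  assumes "vector_space scale" and "finite B" and "\<not> module.dependent scale B"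
  shows "finite (module.span scale B) \<and> card (module.span scale B) = CARD('a) ^ card B"
proof -
  interpret vector_space scale by fact
  from assms(2,3) show ?thesis
  proof (induction B rule: finite_induct)
    case (insert b B)
    have b: "b \<notin> span B" and B: "independent B"
      using insert.prems insert.hyps by (auto simp: independent_insert)
    let ?g = "\<lambda>(c, x). scale c b + x"
    have im: "span (insert b B) = ?g ` (UNIV \<times> span B)"
    proof (intro equalityI subsetI)
      fix x assume "x \<in> span (insert b B)"
      then obtain c where "x - scale c b \<in> span B"
        by (auto simp: span_breakdown_eq)
      then show "x \<in> ?g ` (UNIV \<times> span B)"
        by (intro image_eqI[of _ _ "(c, x - scale c b)"]) auto
    next
      fix x assume "x \<in> ?g ` (UNIV \<times> span B)"
      then obtain c y where "y \<in> span B" "x = scale c b + y"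
        by auto
      then show "x \<in> span (insert b B)"
        unfolding span_breakdown_eq by (intro exI[of _ c]) simp
    qed
    have inj: "inj_on ?g (UNIV \<times> span B)"
    proof (rule inj_onI, clarsimp)
      fix c x d y
      assume xy: "x \<in> span B" "y \<in> span B" and eq: "scale c b + x = scale d b + y"
      from eq have "scale (c - d) b = y - x"
        by (simp add: scale_left_diff_distrib algebra_simps)
      with xy have "scale (c - d) b \<in> span B"
        by (simp add: span_diff)
      with b have "c = d"
        by (metis eq_iff_diff_eq_0 scale_one scale_scale span_scale left_inverse)
      with eq show "c = d \<and> x = y"
        by simp
    qed
    show ?case
      using insert.IH[OF B] insert.hyps
      by (simp add: im card_image[OF inj] card_cartesian_product)
  qed simp
qed

lemma card_subspace:
  fixes U :: "('a::{finite,field} ^ 'n::finite) set"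
  assumes "vec.subspace U"
  shows "card U = CARD('a) ^ vec.dim U"
proof -
  obtain B where B: "B \<subseteq> U" "vec.independent B" "U \<subseteq> vec.span B" "card B = vec.dim U"
    using vec.basis_exists by blast
  have "vec.span B = U"
    using B assms vec.span_subspace by blast
  then show ?thesis
    using card_span_independent[OF vec.vector_space_axioms _ B(2)] B(4) by simp
qed

text \<open>Every fibre of \<open>f\<close> over its image is a translate of the kernel.\<close>

lemma card_additive_kernel:
  fixes f :: "'b::ab_group_add \<Rightarrow> 'c::ab_group_add"
  assumes A: "finite A" "\<And>x y. x \<in> A \<Longrightarrow> y \<in> A \<Longrightarrow> x + y \<in> A" "\<And>x y. x \<in> A \<Longrightarrow> y \<in> A \<Longrightarrow> x - y \<in> A"
    and f: "\<And>x y. x \<in> A \<Longrightarrow> y \<in> A \<Longrightarrow> f (x + y) = f x + f y"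
  shows "card A = card (f ` A) * card {x \<in> A. f x = 0}"
proof -
  have "card {x \<in> A. f x = c} = card {x \<in> A. f x = 0}" if c: "c \<in> f ` A" for c
  proof -
    obtain a where a: "a \<in> A" "c = f a"
      using c by auto
    have diff: "f (x - a) = f x - f a" if "x \<in> A" for x
      using f[of "x - a" a] A(3) that a(1) by simp
    show ?thesis
      by (rule bij_betw_same_card[of "\<lambda>x. x - a"], rule bij_betw_byWitness[where f' = "\<lambda>x. x + a"])
        (use a A f diff in auto)
  qed
  then have "(\<Sum>c\<in>f ` A. card {x \<in> A. f x = c}) = card (f ` A) * card {x \<in> A. f x = 0}"
    by simp
  moreover have "(\<Sum>c\<in>f ` A. card {x \<in> A. f x = c}) = card A"
    using sum.image_gen[OF A(1), of "\<lambda>_. 1::nat" f] by simp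
  ultimately show ?thesis
    by simp
qed

section \<open>Covering the complement of a subspace\<close>

text \<open>
  This is the inductive step of the upper bound. In coordinates, write \<open>V = W' \<oplus> K\<close> with \<open>W'\<close>
  identified with the field \<open>L\<close> of order \<open>q ^ m\<close> by \<open>P\<close>, and with \<open>R\<close> a map from \<open>K\<close> to \<open>L\<close> of
  maximal rank. The members of \<open>G\<close> are the graphs \<open>{x + w | P w = \<alpha> R x}\<close>, with \<open>x \<in> K\<close>, \<open>w \<in> W'\<close>,
  one for each \<open>\<alpha> \<in> L\<close>, and \<open>W\<close> is the kernel of \<open>R\<close> on \<open>V\<close>. It contains \<open>W'\<close>, and is equal to it
  exactly if \<open>R\<close> is injective on \<open>K\<close>, which is possible only for \<open>m \<ge> k\<close>.
\<close>

lemma exists_graph_cover: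
  fixes V :: "('a::{finite,field} ^ 'n::finite) set"
  assumes q: "primepow CARD('a)"
    and V: "vec.subspace V" "vec.dim V = m + k" and m: "m \<ge> 1"
  shows "\<exists>G W. (\<forall>U\<in>G. vec.subspace U \<and> vec.dim U = k) \<and> card G \<le> CARD('a) ^ m \<and>
           vec.subspace W \<and> vec.dim W = max m k \<and> V - W \<subseteq> \<Union>G"
proof -
  let ?q = "CARD('a)"
  let ?s = "\<lambda>c x. to_ac c * (x::'a alg_closure)"
  have q1: "?q > 1"
    by (rule CARD_field_gt_1)
  interpret ac: vector_space ?s
    by unfold_locales (simp_all add: algebra_simps)
  interpret vac: vector_space_pair "(*s) :: 'a \<Rightarrow> 'a ^ 'n \<Rightarrow> _" ?s ..

  define L where "L = {x::'a alg_closure. x ^ (?q ^ m) = x}"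
  have L_add: "x + y \<in> L" if "x \<in> L" "y \<in> L" for x y
    using that power_CARD_power_add[OF q, of x y m] by (simp add: L_def)
  have L_mult: "x * y \<in> L" if "x \<in> L" "y \<in> L" for x y
    using that by (simp add: L_def power_mult_distrib)
  have L_div: "x / y \<in> L" if "x \<in> L" "y \<in> L" for x y
    using that by (simp add: L_def power_divide)
  have L_ac: "to_ac c \<in> L" for c
    by (simp add: L_def field_power_CARD_power_eq flip: to_ac_power)
  have L_diff: "x - y \<in> L" if "x \<in> L" "y \<in> L" for x y
    using L_add[OF that(1) L_mult[OF L_ac[of "-1"] that(2)]] by simp
  have L_sub: "ac.subspace L"
    using L_add L_mult L_ac L_ac[of 0] by (auto simp: ac.subspace_def)
  have card_L: "card L = ?q ^ m"
    unfolding L_def by (rule card_alg_closure_subfield[OF m])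
  have fin_L: "finite L"
    using card_L q1 by (intro card_ge_0_finite) simp
  obtain C where C: "C \<subseteq> L" "ac.independent C" "L \<subseteq> ac.span C"
    by (rule ac.basis_exists[of L])
  have span_C: "ac.span C = L"
    using C L_sub ac.span_subspace by blast
  have fin_C: "finite C"
    using C(1) fin_L finite_subset by blast
  have card_C: "card C = m"
    using card_span_independent[OF ac.vector_space_axioms fin_C C(2)] card_L q1
    by (simp add: span_C)

  \<comment> \<open>\<open>P\<close> carries \<open>BW\<close> to the basis \<open>C\<close> of \<open>L\<close> and kills the rest of \<open>B\<close>;
      \<open>R\<close> embeds \<open>D\<close> into \<open>C\<close> and kills the rest. As \<open>D\<close> and \<open>BW\<close> are disjoint, \<open>R\<close> vanishes
      on the span of \<open>BW\<close>, which \<open>P\<close> maps onto \<open>L\<close>.\<close>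
  obtain B where B: "B \<subseteq> V" "vec.independent B" "V \<subseteq> vec.span B" "card B = m + k"
    by (rule vec.basis_exists[of V]) (simp add: V(2))
  have span_B: "vec.span B = V"
    using B V(1) vec.span_subspace by blast
  obtain BW where BW: "BW \<subseteq> B" "card BW = m"
    using obtain_subset_with_card_n[of m B] B(4) by auto
  have "min m k \<le> card (B - BW)"
    using BW B(4) by (simp add: card_Diff_subset)
  then obtain D where D: "D \<subseteq> B - BW" "card D = min m k"
    using obtain_subset_with_card_n by metis
  obtain p where p: "bij_betw p BW C"
    using finite_same_card_bij[of BW C] fin_C BW card_C by auto
  obtain r where r: "r ` D \<subseteq> C" "inj_on r D"
    using card_le_inj[of D C] fin_C D(2) card_C by auto
  obtain P where P: "Vector_Spaces.linear (*s) ?s P" "\<forall>b\<in>B. P b = (if b \<in> BW then p b else 0)"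
    using vac.linear_independent_extend[OF B(2), of "\<lambda>b. if b \<in> BW then p b else 0"] by blast
  obtain R where R: "Vector_Spaces.linear (*s) ?s R" "\<forall>b\<in>B. R b = (if b \<in> D then r b else 0)"
    using vac.linear_independent_extend[OF B(2), of "\<lambda>b. if b \<in> D then r b else 0"] by blast

  have in_L: "T v \<in> L"
    if T: "Vector_Spaces.linear (*s) ?s T" "T ` B \<subseteq> L" and v: "v \<in> V" for T v
  proof -
    have "T v \<in> T ` vec.span B"
      using v span_B by blast
    also have "\<dots> = ac.span (T ` B)"
      by (rule vac.linear_span_image[OF T(1), symmetric])
    also have "\<dots> \<subseteq> L"
      by (rule ac.span_minimal[OF T(2) L_sub])
    finally show ?thesis .
  qed
  have L0: "0 \<in> L"
    using L_ac[of 0] by simp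
  have P_L: "P v \<in> L" if "v \<in> V" for v
    by (rule in_L[OF P(1) _ that]) (use P(2) p C(1) L0 in \<open>auto simp: bij_betw_def\<close>)
  have R_L: "R v \<in> L" if "v \<in> V" for v
    by (rule in_L[OF R(1) _ that]) (use R(2) r C(1) L0 in auto)
  note lin = vac.linear_add[OF P(1)] vac.linear_add[OF R(1)] vac.linear_scale[OF P(1)]
    vac.linear_scale[OF R(1)] vac.linear_0[OF P(1)] vac.linear_0[OF R(1)]

  have R0: "R b = 0" if "b \<in> B - D" for b
    using that R(2) by simp

  define W where "W = vec.span (B - D)"
  have dim_W: "vec.dim W = max m k"
  proof -
    have "vec.independent (B - D)"
      using B(2) vec.independent_mono by blast
    moreover have "card (B - D) = m + k - min m k"
      using D B(4) by (subst card_Diff_subset) auto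
    ultimately show ?thesis
      unfolding W_def by (simp add: vec.dim_eq_card_independent)
  qed
  \<comment> \<open>\<open>R\<close> is injective on the span of \<open>D\<close>, so its kernel on \<open>V\<close> is no larger than \<open>W\<close>.\<close>
  have R_ne: "R v \<noteq> 0" if v: "v \<in> V - W" for v
  proof
    assume Rv: "R v = 0"
    have "v \<in> vec.span ((B - D) \<union> D)"
      using v D(1) by (simp add: span_B Un_absorb2 subset_iff)
    then obtain w d where wd: "w \<in> W" "d \<in> vec.span D" "v = w + d"
      unfolding vec.span_Un W_def by blast
    have "R w = 0"
      using wd(1) unfolding W_def
      by (rule vac.linear_eq_0_on_span[OF R(1), rotated]) (rule R0)
    with Rv wd(3) have Rd: "R d = 0"
      by (simp add: lin)
    have RD: "R b = r b" if "b \<in> D" for b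
      using that D(1) R(2) by auto
    have "d = 0"
    proof (rule vac.linear_indep_image_lemma[OF R(1) _ _ _ wd(2) Rd])
      show "ac.independent (R ` D)"
        using RD r(1) C(2) ac.independent_mono[of C "R ` D"] by (auto simp: image_def)
      show "inj_on R D"
        using r(2) RD by (simp cong: inj_on_cong)
    qed simp
    with wd v show False
      by simp
  qed

  define g where "g = (\<lambda>\<alpha>. {v \<in> V. P v - \<alpha> * R v = 0})"
  have g: "vec.subspace (g \<alpha>) \<and> vec.dim (g \<alpha>) = k" if \<alpha>: "\<alpha> \<in> L" for \<alpha>
  proof
    show sub: "vec.subspace (g \<alpha>)"
      using V(1) by (auto simp: g_def vec.subspace_def lin algebra_simps)
    have "(\<lambda>v. P v - \<alpha> * R v) ` V = L"
    proof (intro equalityI subsetI)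
      fix x assume "x \<in> L"
      also have "L = ac.span (P ` BW)"
        using p P(2) BW(1) span_C by (metis (mono_tags, lifting) bij_betw_def image_cong subsetD)
      also have "\<dots> = P ` vec.span BW"
        by (rule vac.linear_span_image[OF P(1)])
      finally obtain w where w: "w \<in> vec.span BW" "x = P w"
        by blast
      have "R w = 0"
        using w(1) by (rule vac.linear_eq_0_on_span[OF R(1), rotated]) (use R0 D(1) BW(1) in blast)
      moreover have "w \<in> V"
        using w(1) vec.span_mono[OF BW(1)] span_B by blast
      ultimately show "x \<in> (\<lambda>v. P v - \<alpha> * R v) ` V"
        using w(2) by (intro image_eqI[of _ _ w]) auto
    qed (use \<alpha> P_L R_L L_diff L_mult in auto)
    moreover have "card V = card ((\<lambda>v. P v - \<alpha> * R v) ` V) * card (g \<alpha>)"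
      unfolding g_def using V(1)
      by (intro card_additive_kernel) (auto simp: lin vec.subspace_add vec.subspace_diff algebra_simps)
    \<comment> \<open>The kernel of a map onto \<open>L\<close> has \<open>q ^ (m + k) / q ^ m\<close> elements.\<close>
    ultimately have "?q ^ (m + k) = ?q ^ m * ?q ^ vec.dim (g \<alpha>)"
      using card_L card_subspace[OF V(1)] card_subspace[OF sub] V(2) by simp
    then show "vec.dim (g \<alpha>) = k"
      using q1 by (simp add: power_add)
  qed

  have cover: "V - W \<subseteq> \<Union>(g ` L)"
  proof
    fix v assume v: "v \<in> V - W"
    then have "v \<in> g (P v / R v)"
      using R_ne[OF v] by (simp add: g_def)
    moreover have "P v / R v \<in> L"
      using v P_L R_L L_div by blast
    ultimately show "v \<in> \<Union>(g ` L)"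
      by blast
  qed
  show ?thesis
    by (rule exI[of _ "g ` L"], rule exI[of _ W])
      (use g cover dim_W card_image_le[OF fin_L, of g] card_L in \<open>auto simp: W_def\<close>)
qed

section \<open>The covering number\<close>

lemma ceiling_ratio_step:
  fixes q :: real
  assumes "q > 1" and "k \<ge> 1"
  shows "\<lceil>(q ^ (m + k) - 1) / (q ^ k - 1)\<rceil> = \<lceil>q ^ m + (q ^ m - 1) / (q ^ k - 1)\<rceil>"
proof -
  have "q ^ k > 1"
    using assms by (intro one_less_power) auto
  then have "(q ^ (m + k) - 1) / (q ^ k - 1) = q ^ m + (q ^ m - 1) / (q ^ k - 1)"
    by (simp add: field_simps power_add)
  then show ?thesis
    by simp
qed

text \<open>
  Repeated use of \<open>exists_graph_cover\<close>. The cover is built for every subspace \<open>V\<close>, because the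
  part left over after a step is a proper subspace of the ambient space.
\<close>

lemma exists_cover:
  fixes V :: "('a::{finite,field} ^ 'n::finite) set"
  assumes q: "primepow CARD('a)" and k: "k \<ge> 1"
  shows "vec.subspace V \<Longrightarrow> k \<le> vec.dim V \<Longrightarrow>
    \<exists>S. (\<forall>U\<in>S. vec.subspace U \<and> vec.dim U = k) \<and> V \<subseteq> \<Union>S \<and>
      int (card S) \<le> \<lceil>(real CARD('a) ^ vec.dim V - 1) / (real CARD('a) ^ k - 1)\<rceil>"
proof (induction "vec.dim V" arbitrary: V rule: less_induct)
  case less
  let ?q = "CARD('a)"
  have q1: "real ?q > 1"
    using CARD_field_gt_1[where 'a = 'a] by simp
  have qk: "real ?q ^ k > 1"
    using q1 k by (intro one_less_power) auto
  show ?case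
  proof (cases "vec.dim V = k")
    case True
    then show ?thesis
      using less.prems qk by (intro exI[of _ "{V}"]) simp
  next
    case False
    define m where "m = vec.dim V - k"
    have m: "m \<ge> 1" "vec.dim V = m + k"
      using False less.prems by (auto simp: m_def)
    obtain G W where G: "\<forall>U\<in>G. vec.subspace U \<and> vec.dim U = k" "card G \<le> ?q ^ m"
      and W: "vec.subspace W" "vec.dim W = max m k" and cover: "V - W \<subseteq> \<Union>G"
      using exists_graph_cover[OF q less.prems(1) m(2,1)] by blast
    obtain S where S: "\<forall>U\<in>S. vec.subspace U \<and> vec.dim U = k" "W \<subseteq> \<Union>S"
      "int (card S) \<le> \<lceil>(real ?q ^ max m k - 1) / (real ?q ^ k - 1)\<rceil>"
      using less.hyps[of W] W m k by auto
    have qm: "real ?q ^ m > 1"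
      using q1 m by (intro one_less_power) auto
    \<comment> \<open>For \<open>m < k\<close> both sides are \<open>1\<close>: the space \<open>W\<close> that remains has dimension \<open>k\<close> and costs
        one subspace, and \<open>(q ^ m - 1) / (q ^ k - 1)\<close> lies strictly between 0 and 1.\<close>
    have ratio: "\<lceil>(real ?q ^ max m k - 1) / (real ?q ^ k - 1)\<rceil> = \<lceil>(real ?q ^ m - 1) / (real ?q ^ k - 1)\<rceil>"
    proof (cases "m < k")
      case True
      then have "real ?q ^ m < real ?q ^ k"
        using q1 by (intro power_strict_increasing) auto
      then have "\<lceil>(real ?q ^ m - 1) / (real ?q ^ k - 1)\<rceil> = 1"
        using qm by (intro ceiling_unique) (auto simp: field_simps)
      then show ?thesis
        using True qk by (simp add: max_def)
    qed (simp add: max_def)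
    have "int (card (G \<union> S)) \<le> int (?q ^ m) + int (card S)"
      using card_Un_le[of G S] G(2) by linarith
    also have "\<dots> \<le> int (?q ^ m) + \<lceil>(real ?q ^ m - 1) / (real ?q ^ k - 1)\<rceil>"
      using S(3) ratio by simp
    also have "\<dots> = \<lceil>(real ?q ^ m - 1) / (real ?q ^ k - 1) + of_int (int (?q ^ m))\<rceil>"
      by (subst ceiling_add_of_int) simp
    also have "\<dots> = \<lceil>(real ?q ^ vec.dim V - 1) / (real ?q ^ k - 1)\<rceil>"
      using ceiling_ratio_step[OF q1 k, of m] m(2) by (simp add: add.commute)
    finally show ?thesis
      using G(1) S cover by (intro exI[of _ "G \<union> S"]) auto
  qed
qed

text \<open>
  Every nonzero vector spans a one-dimensional subspace, hence lies in some member of \<open>S\<close>,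
  and each member contributes only \<open>q ^ k - 1\<close> nonzero vectors.
\<close>

lemma q_covering_design_card_ge:
  fixes S :: "('a::{finite,field} ^ 'n::finite) set set"
  assumes "q_covering_design k 1 S" and k: "k \<ge> 1"
  shows "\<lceil>(real CARD('a) ^ CARD('n) - 1) / (real CARD('a) ^ k - 1)\<rceil> \<le> int (card S)"
proof -
  let ?q = "CARD('a)"
  have q1: "?q > 1"
    by (rule CARD_field_gt_1)
  have qk: "?q ^ k > 1"
    using q1 k by (intro one_less_power) auto
  have dim: "vec.subspace U \<and> vec.dim U = k" if "U \<in> S" for U
    using assms(1) that by (auto simp: q_covering_design_def subspaces_of_dim_def)
  have "UNIV - {0} \<subseteq> (\<Union>U\<in>S. U - {0})"
  proof
    fix v :: "'a ^ 'n" assume v: "v \<in> UNIV - {0}"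
    then have "vec.span {v} \<in> subspaces_of_dim 1"
      by (simp add: subspaces_of_dim_def)
    then obtain U where "U \<in> S" "vec.span {v} \<subseteq> U"
      using assms(1) by (auto simp: q_covering_design_def)
    then show "v \<in> (\<Union>U\<in>S. U - {0})"
      using v vec.span_base[of v "{v}"] by auto
  qed
  then have "card (UNIV - {0::'a ^ 'n}) \<le> card (\<Union>U\<in>S. U - {0})"
    by (intro card_mono) auto
  also have "\<dots> \<le> (\<Sum>U\<in>S. card (U - {0}))"
    by (intro card_UN_le) simp
  also have "\<dots> = (\<Sum>U\<in>S. ?q ^ k - 1)"
    by (intro sum.cong refl) (simp add: card_Diff_singleton vec.subspace_0 dim card_subspace)
  finally have "?q ^ CARD('n) - 1 \<le> card S * (?q ^ k - 1)"
    by (simp add: card_Diff_singleton)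
  then have "real (?q ^ CARD('n) - 1) \<le> real (card S * (?q ^ k - 1))"
    by (rule of_nat_mono)
  then have "real ?q ^ CARD('n) - 1 \<le> real (card S) * (real ?q ^ k - 1)"
    using q1 qk by (simp add: of_nat_diff)
  moreover have "real ?q ^ k > 1"
    using q1 k by (intro one_less_power) auto
  ultimately show ?thesis
    by (simp add: ceiling_le_iff pos_divide_le_eq)
qed

theorem corollary4:
  fixes q n k :: nat
  assumes "primepow q"
    and "CARD('a::{finite,field}) = q"
    and "CARD('n::finite) = n"
    and "1 \<le> k" and "k \<le> n"
  shows "int (q_covering_number TYPE('a) TYPE('n) k 1)
           = \<lceil>(real q ^ n - 1) / (real q ^ k - 1)\<rceil>"
proof -
  let ?c = "\<lceil>(real q ^ n - 1) / (real q ^ k - 1)\<rceil>"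
  let ?P = "\<lambda>m. \<exists>S :: ('a ^ 'n) set set. q_covering_design k 1 S \<and> card S = m"
  have dim_UNIV: "vec.dim (UNIV :: ('a ^ 'n) set) = n"
    using assms(3) by (simp add: card_cart_basis)
  obtain S :: "('a ^ 'n) set set" where S: "\<forall>U\<in>S. vec.subspace U \<and> vec.dim U = k"
    "UNIV \<subseteq> \<Union>S" "int (card S) \<le> ?c"
    using exists_cover[of k "UNIV :: ('a ^ 'n) set"] assms dim_UNIV by auto
  have "q_covering_design k 1 S"
    unfolding q_covering_design_def
  proof safe
    fix U assume "U \<in> S"
    then show "U \<in> subspaces_of_dim k"
      using S(1) by (simp add: subspaces_of_dim_def)
  next
    fix T :: "('a ^ 'n) set" assume "T \<in> subspaces_of_dim 1"
    then have T: "vec.subspace T" "vec.dim T = 1"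
      by (auto simp: subspaces_of_dim_def)
    obtain B where B: "B \<subseteq> T" "T \<subseteq> vec.span B" "card B = 1"
      using vec.basis_exists T(2) by metis
    then obtain b where b: "B = {b}"
      using card_1_singletonE by blast
    obtain U where U: "U \<in> S" "b \<in> U"
      using S(2) by blast
    then have "vec.span B \<subseteq> U"
      using S(1) b by (intro vec.span_minimal) auto
    then show "\<exists>U\<in>S. T \<subseteq> U"
      using U B(2) by blast
  qed
  then have P: "?P (card S)"
    by blast
  have "q_covering_number TYPE('a) TYPE('n) k 1 \<le> card S"
    unfolding q_covering_number_def using P by (rule Least_le)
  moreover have "?P (q_covering_number TYPE('a) TYPE('n) k 1)"
    unfolding q_covering_number_def using P by (rule LeastI)
  then have "?c \<le> int (q_covering_number TYPE('a) TYPE('n) k 1)"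
    using q_covering_design_card_ge[where 'a='a and 'n='n] assms(2-4) by metis
  ultimately show ?thesis
    using S(3) by linarith
qed

end
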